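(* Let $n\ge 4$ and let $M_n(2)=\langle a,b\mid a^{2^{n-1}}=b^2=1,\ bab^{-1}=a^{1+2^{n-2}}\rangle$ be the modular maximal-cyclic group of order $2^n$. Then $w(M_n(2))=2(n-1)$.
   Context: For a finite group $G$, a $G$-transfer system is a partial order $\to$ on the set $\operatorname{Sub}(G)$ of subgroups of $G$ such that: (i) $K\to H$ implies $K\le H$; (ii) $H\to H$ for all $H$; (iii) $L\to K$ and $K\to H$ imply $L\to H$; (iv) $K\to H$ and $L\le H$ imply $K\cap L\to H\cap L$; (v) $K\to H$ implies $gKg^{-1}\to gHg^{-1}$ for all $g\in G$. A set $S$ of pairs $(K,H)$ with $K\le H$ generates the smallest transfer system containing $S$. The complete $G$-transfer system is the one with $K\to H$ for all $K\le H$. The width $w(G)$ is the minimal cardinality of a set generating the complete $G$-transfer system. *)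

theory Defs
  imports "HOL-Algebra.Group_Action"
begin

section \<open>Transfer systems\<close>

text \<open>A relation \<open>K \<rightarrow> H\<close> on subgroups is a set \<open>T\<close> of pairs \<open>(K, H)\<close>. Reflexivity and
  transitivity are part of \<^const>\<open>partial_order_on\<close>, as is the restriction of \<open>T\<close> to pairs of
  subgroups of \<open>G\<close>.\<close>

definition transfer_system :: "('a, 'b) monoid_scheme \<Rightarrow> ('a set \<times> 'a set) set \<Rightarrow> bool" where
  "transfer_system G T \<longleftrightarrow>
     partial_order_on {H. subgroup H G} T \<and>
     (\<forall>K H. (K, H) \<in> T \<longrightarrow> K \<subseteq> H) \<and>
     (\<forall>K H L. (K, H) \<in> T \<and> subgroup L G \<and> L \<subseteq> H \<longrightarrow> (K \<inter> L, H \<inter> L) \<in> T) \<and>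
     (\<forall>K H. \<forall>g\<in>carrier G. (K, H) \<in> T \<longrightarrow>
        (g <#\<^bsub>G\<^esub> K #>\<^bsub>G\<^esub> inv\<^bsub>G\<^esub> g, g <#\<^bsub>G\<^esub> H #>\<^bsub>G\<^esub> inv\<^bsub>G\<^esub> g) \<in> T)"

definition complete_transfer_system :: "('a, 'b) monoid_scheme \<Rightarrow> ('a set \<times> 'a set) set" where
  "complete_transfer_system G = {(K, H). subgroup K G \<and> subgroup H G \<and> K \<subseteq> H}"

definition generated_transfer_system ::
    "('a, 'b) monoid_scheme \<Rightarrow> ('a set \<times> 'a set) set \<Rightarrow> ('a set \<times> 'a set) set" where
  "generated_transfer_system G S = \<Inter>{T. transfer_system G T \<and> S \<subseteq> T}"

definition width :: "('a, 'b) monoid_scheme \<Rightarrow> nat" where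
  "width G = (LEAST k. \<exists>S. S \<subseteq> complete_transfer_system G \<and> finite S \<and> card S = k \<and>
     generated_transfer_system G S = complete_transfer_system G)"

lemma (in group) transfer_system_complete:
  "transfer_system G (complete_transfer_system G)"
proof -
  have "partial_order_on {H. subgroup H G} (complete_transfer_system G)"
    unfolding partial_order_on_def preorder_on_def refl_on_def trans_def antisym_def
      complete_transfer_system_def by blast
  moreover have "g <# K #> inv g \<subseteq> g <# H #> inv g" if "K \<subseteq> H" for g K H
    using that unfolding l_coset_def r_coset_def by blast
  ultimately show ?thesis
    unfolding transfer_system_def
    by (auto simp: complete_transfer_system_def
        intro: subgroups_Inter_pair subgroup_conjugation_is_surj2)
qed

text \<open>The intersection in \<^const>\<open>generated_transfer_system\<close> is the smallest transfer system
  containing \<open>S\<close>.\<close>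

lemma (in group) transfer_system_generated:
  assumes "S \<subseteq> complete_transfer_system G"
  shows "transfer_system G (generated_transfer_system G S)"
proof -
  let ?\<T> = "{T. transfer_system G T \<and> S \<subseteq> T}"
  have c: "complete_transfer_system G \<in> ?\<T>"
    using assms transfer_system_complete by blast
  have po: "partial_order_on {H. subgroup H G} T" if "T \<in> ?\<T>" for T
    using that by (auto simp: transfer_system_def)
  have "\<Inter>?\<T> \<subseteq> complete_transfer_system G"
    using c by blast
  moreover have "refl_on {H. subgroup H G} (\<Inter>?\<T>)"
    using po unfolding partial_order_on_def preorder_on_def refl_on_def by blast
  moreover have "trans (\<Inter>?\<T>)"
  proof (rule transI)
    fix x y z assume xy: "(x, y) \<in> \<Inter>?\<T>" and yz: "(y, z) \<in> \<Inter>?\<T>"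
    show "(x, z) \<in> \<Inter>?\<T>"
    proof
      fix T assume T: "T \<in> ?\<T>"
      then have "trans T"
        using po by (simp add: partial_order_on_def preorder_on_def)
      then show "(x, z) \<in> T"
        using xy yz T by (meson InterD transD)
    qed
  qed
  ultimately have "partial_order_on {H. subgroup H G} (\<Inter>?\<T>)"
    unfolding partial_order_on_def preorder_on_def antisym_def complete_transfer_system_def
    by blast
  moreover have "\<forall>K H. (K, H) \<in> \<Inter>?\<T> \<longrightarrow> K \<subseteq> H"
    using c by (auto simp: complete_transfer_system_def)
  moreover have "\<forall>K H L. (K, H) \<in> \<Inter>?\<T> \<and> subgroup L G \<and> L \<subseteq> H \<longrightarrow> (K \<inter> L, H \<inter> L) \<in> \<Inter>?\<T>"
    by (simp add: transfer_system_def)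
  moreover have "\<forall>K H. \<forall>g\<in>carrier G. (K, H) \<in> \<Inter>?\<T> \<longrightarrow>
      (g <# K #> inv g, g <# H #> inv g) \<in> \<Inter>?\<T>"
    by (simp add: transfer_system_def)
  ultimately show ?thesis
    unfolding generated_transfer_system_def transfer_system_def[of _ "\<Inter>?\<T>"] by (intro conjI)
qed


section \<open>Groups given by generators and relations\<close>

text \<open>A letter \<open>(x, True)\<close> stands for the generator \<open>x\<close>, and \<open>(x, False)\<close> for its inverse. The
  pair \<open>(u, v) \<in> R\<close> is the defining relation \<open>u = v\<close>.\<close>

type_synonym 'g word = "('g \<times> bool) list"

inductive word_eq :: "('g word \<times> 'g word) set \<Rightarrow> 'g word \<Rightarrow> 'g word \<Rightarrow> bool"
  for R :: "('g word \<times> 'g word) set" where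
  relation: "(u, v) \<in> R \<Longrightarrow> word_eq R u v"
| cancel: "word_eq R [(x, e), (x, \<not> e)] []"
| refl: "word_eq R u u"
| sym: "word_eq R u v \<Longrightarrow> word_eq R v u"
| trans: "word_eq R u v \<Longrightarrow> word_eq R v w \<Longrightarrow> word_eq R u w"
| append: "word_eq R u u' \<Longrightarrow> word_eq R v v' \<Longrightarrow> word_eq R (u @ v) (u' @ v')"

definition word_class :: "('g word \<times> 'g word) set \<Rightarrow> 'g word \<Rightarrow> 'g word set" where
  "word_class R u = {v. word_eq R u v}"

definition presented_group :: "('g word \<times> 'g word) set \<Rightarrow> 'g word set monoid" where
  "presented_group R =
     \<lparr>carrier = range (word_class R),
      mult = (\<lambda>U V. \<Union>u\<in>U. \<Union>v\<in>V. word_class R (u @ v)),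
      one = word_class R []\<rparr>"

lemma word_class_eq_iff: "word_class R u = word_class R v \<longleftrightarrow> word_eq R u v"
proof
  assume "word_class R u = word_class R v"
  moreover have "v \<in> word_class R v"
    by (simp add: word_class_def word_eq.refl)
  ultimately show "word_eq R u v"
    by (auto simp: word_class_def)
next
  assume uv: "word_eq R u v"
  show "word_class R u = word_class R v"
    unfolding word_class_def
    using word_eq.trans[OF uv] word_eq.trans[OF word_eq.sym[OF uv]] by blast
qed

lemma mult_presented_group:
  "word_class R u \<otimes>\<^bsub>presented_group R\<^esub> word_class R v = word_class R (u @ v)"
proof -
  have "word_class R (u' @ v') = word_class R (u @ v)"
    if "u' \<in> word_class R u" "v' \<in> word_class R v" for u' v'
    using that unfolding word_class_eq_iff
    by (simp add: word_class_def word_eq.append word_eq.sym)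
  moreover have "u \<in> word_class R u" "v \<in> word_class R v"
    by (auto simp: word_class_def intro: word_eq.refl)
  ultimately have "(\<Union>u'\<in>word_class R u. \<Union>v'\<in>word_class R v. word_class R (u' @ v'))
      = word_class R (u @ v)"
    by blast
  then show ?thesis
    by (simp add: presented_group_def)
qed

lemma group_presented_group: "group (presented_group R)"
proof (rule groupI)
  have carrier: "carrier (presented_group R) = range (word_class R)"
    and one: "\<one>\<^bsub>presented_group R\<^esub> = word_class R []"
    by (simp_all add: presented_group_def)
  note simps = carrier one mult_presented_group
  show "\<one>\<^bsub>presented_group R\<^esub> \<in> carrier (presented_group R)"
    by (simp add: simps)
  fix X assume X: "X \<in> carrier (presented_group R)"
  then show "\<one>\<^bsub>presented_group R\<^esub> \<otimes>\<^bsub>presented_group R\<^esub> X = X"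
    by (auto simp: simps)
  have "\<exists>v. word_eq R (v @ u) []" for u
  proof (induction u)
    case Nil
    show ?case by (auto intro: word_eq.refl)
  next
    case (Cons l u)
    then obtain v where v: "word_eq R (v @ u) []" by blast
    obtain x e where l: "l = (x, e)" by (cases l)
    have "word_eq R [(x, \<not> e), l] []"
      using word_eq.cancel[of R x "\<not> e"] by (simp add: l)
    then have "word_eq R (v @ [(x, \<not> e), l] @ u) (v @ [] @ u)"
      by (intro word_eq.append word_eq.refl)
    then have "word_eq R ((v @ [(x, \<not> e)]) @ l # u) []"
      using word_eq.trans[OF _ v] by simp
    then show ?case by blast
  qed
  then show "\<exists>Y\<in>carrier (presented_group R). Y \<otimes>\<^bsub>presented_group R\<^esub> X = \<one>\<^bsub>presented_group R\<^esub>"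
    using X by (auto simp: simps word_class_eq_iff)
  fix Y assume Y: "Y \<in> carrier (presented_group R)"
  show "X \<otimes>\<^bsub>presented_group R\<^esub> Y \<in> carrier (presented_group R)"
    using X Y by (auto simp: simps)
  fix Z assume Z: "Z \<in> carrier (presented_group R)"
  show "X \<otimes>\<^bsub>presented_group R\<^esub> Y \<otimes>\<^bsub>presented_group R\<^esub> Z
      = X \<otimes>\<^bsub>presented_group R\<^esub> (Y \<otimes>\<^bsub>presented_group R\<^esub> Z)"
    using X Y Z by (auto simp: simps)
qed


section \<open>Modular maximal-cyclic groups\<close>

datatype two_gens = Gen_a | Gen_b

definition modular_group :: "nat \<Rightarrow> two_gens word set monoid" where
  "modular_group n = presented_group
     (let a = (Gen_a, True); b = (Gen_b, True); b_inv = (Gen_b, False) in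
       {(replicate (2 ^ (n - 1)) a, []),
        ([b, b], []),
        ([b, a, b_inv], replicate (1 + 2 ^ (n - 2)) a)})"

end

theory Submission
  imports Defs "HOL-Computational_Algebra.Primes"
begin

text \<open>Call a subgroup \<open>K\<close> meet-irreducible if among the subgroups properly containing \<open>K\<close> there is
  a least one. The width of a group whose subgroups are all obtained from \<open>G\<close> and conjugates of
  meet-irreducible subgroups by finite intersections is the number of conjugacy classes of
  meet-irreducible subgroups. For the lower bound, the pairs \<open>(L, H)\<close> with \<open>L = H\<close> or \<open>L\<close> not
  conjugate to \<open>K\<close> form a proper transfer system, so a generating set contains a pair with source
  conjugate to \<open>K\<close>. For the upper bound, the pairs \<open>(K, G)\<close> generate \<open>(L, G)\<close> for every
  intersection \<open>L\<close> of conjugates of the \<open>K\<close>, and by restriction everything.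

  In \<open>M\<^sub>n(2)\<close> the subgroups are \<open>D m = \<langle>a^(2^m), b\<rangle>\<close>, \<open>B m = \<langle>a^(2^m) b\<rangle>\<close> and
  \<open>\<langle>a^(2^m)\<rangle> = \<langle>a\<rangle> \<inter> D m\<close>. The meet-irreducible classes are those of \<open>\<langle>a\<rangle>\<close>, of \<open>D m\<close> for
  \<open>1 \<le> m \<le> n - 1\<close> and of \<open>B m\<close> for \<open>m \<le> n - 3\<close>, while \<open>B (n - 2)\<close> is conjugate to \<open>D (n - 1)\<close>.\<close>

section \<open>Meet-irreducible subgroups and width\<close>

lemma conjugate_image: "g <#\<^bsub>G\<^esub> K #>\<^bsub>G\<^esub> inv\<^bsub>G\<^esub> g = (\<lambda>x. g \<otimes>\<^bsub>G\<^esub> x \<otimes>\<^bsub>G\<^esub> inv\<^bsub>G\<^esub> g) ` K"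
  by (auto simp: l_coset_def r_coset_def)

lemma conjugate_mono:
  "K \<subseteq> H \<Longrightarrow> g <#\<^bsub>G\<^esub> K #>\<^bsub>G\<^esub> inv\<^bsub>G\<^esub> g \<subseteq> g <#\<^bsub>G\<^esub> H #>\<^bsub>G\<^esub> inv\<^bsub>G\<^esub> g"
  by (auto simp: conjugate_image)

context group
begin

lemma conjugate_conjugate:
  assumes "g \<in> carrier G" "h \<in> carrier G" "K \<subseteq> carrier G"
  shows "g <# (h <# K #> inv h) #> inv g = (g \<otimes> h) <# K #> inv (g \<otimes> h)"
  using assms unfolding conjugate_image image_image
  by (intro image_cong) (auto simp: inv_mult_group m_assoc subset_iff)

lemma conjugate_one:
  assumes "K \<subseteq> carrier G"
  shows "\<one> <# K #> inv \<one> = K"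
proof -
  have "(\<lambda>x. \<one> \<otimes> x \<otimes> inv \<one>) ` K = (\<lambda>x. x) ` K"
    using assms by (intro image_cong) auto
  then show ?thesis unfolding conjugate_image by simp
qed

lemma conjugate_inv_conjugate:
  assumes "g \<in> carrier G" "K \<subseteq> carrier G"
  shows "inv g <# (g <# K #> inv g) #> inv (inv g) = K"
    and "g <# (inv g <# K #> inv (inv g)) #> inv g = K"
  using assms conjugate_conjugate[of "inv g" g K] conjugate_conjugate[of g "inv g" K]
    conjugate_one by simp_all

text \<open>In a finite subgroup lattice this says that \<open>K\<close> is a proper subgroup and
  not an intersection of two strictly larger ones. Strictness of \<open>K \<subset> M\<close>
  excludes \<open>carrier G\<close>.\<close>

definition meet_irreducible :: "'a set \<Rightarrow> bool" where
  "meet_irreducible K \<longleftrightarrow> subgroup K G \<and>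
     (\<exists>M. subgroup M G \<and> K \<subset> M \<and> (\<forall>H. subgroup H G \<and> K \<subset> H \<longrightarrow> M \<subseteq> H))"

definition conjugate_to :: "'a set \<Rightarrow> 'a set \<Rightarrow> bool" where
  "conjugate_to K L \<longleftrightarrow> (\<exists>g\<in>carrier G. L = g <# K #> inv g)"

lemma conjugate_to_sym:
  assumes "conjugate_to K L" "K \<subseteq> carrier G"
  shows "conjugate_to L K"
  using assms conjugate_inv_conjugate(1) unfolding conjugate_to_def
  by (metis inv_closed)

lemma conjugate_to_trans:
  assumes "conjugate_to K L" "conjugate_to L M" "K \<subseteq> carrier G"
  shows "conjugate_to K M"
  using assms conjugate_conjugate unfolding conjugate_to_def
  by (metis m_closed)

text \<open>Conjugation by \<open>g\<close> is an order automorphism of the subgroups, with inverse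
  conjugation by \<open>inv g\<close>, so it carries the least proper overgroup \<open>M\<close> of
  \<open>K\<close> to that of \<open>L\<close>.\<close>

lemma meet_irreducible_conjugate_to:
  assumes K: "meet_irreducible K" and KL: "conjugate_to K L"
  shows "meet_irreducible L"
proof -
  obtain M where M: "subgroup M G" "K \<subset> M" "\<And>H. subgroup H G \<Longrightarrow> K \<subset> H \<Longrightarrow> M \<subseteq> H"
    and sK: "subgroup K G"
    using K by (auto simp: meet_irreducible_def)
  obtain g where g: "g \<in> carrier G" "L = g <# K #> inv g"
    using KL by (auto simp: conjugate_to_def)
  let ?M = "g <# M #> inv g"
  have sub: "X \<subseteq> carrier G" if "subgroup X G" for X
    using that by (rule subgroup.subset)
  have strict: "x <# X #> inv x \<subset> x <# Y #> inv x"
    if "x \<in> carrier G" "X \<subset> Y" "Y \<subseteq> carrier G" for x X Y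
  proof -
    have "x <# X #> inv x \<noteq> x <# Y #> inv x"
      using that conjugate_inv_conjugate(1) by (metis order_trans psubset_eq)
    then show ?thesis
      using conjugate_mono[of X Y G x] that(2) by blast
  qed
  have "?M \<subseteq> H" if H: "subgroup H G" "L \<subset> H" for H
  proof -
    have "inv g <# L #> inv (inv g) \<subset> inv g <# H #> inv (inv g)"
      using H g sub by (intro strict) auto
    then have "K \<subset> inv g <# H #> inv (inv g)"
      unfolding g(2) conjugate_inv_conjugate(1)[OF g(1) sub[OF sK]] .
    then have "M \<subseteq> inv g <# H #> inv (inv g)"
      by (intro M(3) subgroup_conjugation_is_surj2 H(1) inv_closed g(1))
    from conjugate_mono[OF this, of G g] show ?thesis
      unfolding conjugate_inv_conjugate(2)[OF g(1) sub[OF H(1)]] .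
  qed
  moreover have "L \<subset> ?M" "subgroup L G" "subgroup ?M G"
    using strict[OF g(1) M(2)] sub M(1) g sK subgroup_conjugation_is_surj2 by auto
  ultimately show ?thesis
    unfolding meet_irreducible_def by blast
qed

section \<open>Lower bound: sources of generating pairs\<close>

lemma meet_irreducible_source:
  assumes K: "meet_irreducible K"
    and S: "S \<subseteq> complete_transfer_system G"
      "generated_transfer_system G S = complete_transfer_system G"
  shows "\<exists>(L, H)\<in>S. conjugate_to K L"
proof (rule ccontr)
  assume contra: "\<not> ?thesis"
  define T where "T = {(L, H) \<in> complete_transfer_system G. conjugate_to K L \<longrightarrow> H = L}"
  note comp = transfer_system_complete[unfolded transfer_system_def]
  have T_iff: "(L, H) \<in> T \<longleftrightarrow> subgroup L G \<and> subgroup H G \<and> L \<subseteq> H \<and> (conjugate_to K L \<longrightarrow> H = L)" for L H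
    by (auto simp: T_def complete_transfer_system_def)
  have sK: "subgroup K G" and Kc: "K \<subseteq> carrier G"
    using K by (auto simp: meet_irreducible_def subgroup.subset)
  have "transfer_system G T"
    unfolding transfer_system_def
  proof (intro conjI allI impI ballI)
    show "partial_order_on {H. subgroup H G} T"
      unfolding partial_order_on_def preorder_on_def refl_on_def trans_def antisym_def T_def
        complete_transfer_system_def by auto
    show "L \<subseteq> H" if "(L, H) \<in> T" for L H
      using that by (simp add: T_iff)
    show "(L \<inter> P, H \<inter> P) \<in> T" if LHP: "(L, H) \<in> T \<and> subgroup P G \<and> P \<subseteq> H" for L H P
    proof -
      \<comment> \<open>The restricted pair must be trivial here. Otherwise
        \<open>L \<inter> P\<close> is proper in \<open>P\<close>, and also in \<open>L\<close>,
        since equality would give \<open>H = L\<close> and so \<open>P \<subseteq> L\<close>. Then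
        \<open>L\<close> and \<open>P\<close> both contain the least proper overgroup of their own
        intersection.\<close>
      have "P = L \<inter> P" if KLP: "conjugate_to K (L \<inter> P)"
      proof (rule ccontr)
        assume "P \<noteq> L \<inter> P"
        then have "L \<inter> P \<subset> P" by blast
        moreover obtain M where M: "L \<inter> P \<subset> M" "\<And>X. subgroup X G \<Longrightarrow> L \<inter> P \<subset> X \<Longrightarrow> M \<subseteq> X"
          using meet_irreducible_conjugate_to[OF K KLP] by (auto simp: meet_irreducible_def)
        moreover have "L \<inter> P \<subset> L"
        proof -
          have "L \<inter> P \<noteq> L" using LHP KLP \<open>L \<inter> P \<subset> P\<close> by (auto simp: T_iff)
          then show ?thesis by blast
        qed
        ultimately have "M \<subseteq> L \<inter> P" using LHP by (simp add: T_iff)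
        then show False using M(1) by blast
      qed
      moreover have "H \<inter> P = P" using LHP by blast
      ultimately show ?thesis using LHP by (auto simp: T_iff subgroups_Inter_pair)
    qed
    show "(g <# L #> inv g, g <# H #> inv g) \<in> T" if g: "g \<in> carrier G" and LH: "(L, H) \<in> T" for L H g
    proof -
      have "conjugate_to K L" if "conjugate_to K (g <# L #> inv g)"
      proof -
        have "conjugate_to (g <# L #> inv g) L"
          using g LH conjugate_to_sym[of L] by (auto simp: T_iff conjugate_to_def subgroup.subset)
        then show ?thesis
          using that conjugate_to_trans Kc by blast
      qed
      then show ?thesis
        using g LH conjugate_mono[of L H G g] subgroup_conjugation_is_surj2 by (auto simp: T_iff)
    qed
  qed
  moreover have "S \<subseteq> T"
    using S(1) contra by (auto simp: T_def)
  ultimately have "complete_transfer_system G \<subseteq> T"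
    unfolding S(2)[symmetric] generated_transfer_system_def by blast
  \<comment> \<open>The pair \<open>(K, M)\<close> is in the complete system but not in
    \<open>T\<close>, as \<open>K\<close> is conjugate to itself.\<close>
  moreover obtain M where M: "subgroup M G" "K \<subset> M"
    using K by (auto simp: meet_irreducible_def)
  then have "(K, M) \<in> complete_transfer_system G"
    using sK by (auto simp: complete_transfer_system_def)
  ultimately have "(K, M) \<in> T" by (rule subsetD)
  moreover have "conjugate_to K K"
    using conjugate_one[OF Kc] unfolding conjugate_to_def by (metis one_closed)
  ultimately show False
    using M(2) unfolding T_iff by blast
qed

section \<open>Upper bound: pairs with the whole group as target\<close>

lemma transfer_system_eq_complete:
  assumes T: "transfer_system G T" and top: "\<And>L. subgroup L G \<Longrightarrow> (L, carrier G) \<in> T"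
  shows "T = complete_transfer_system G"
proof (rule antisym)
  show "T \<subseteq> complete_transfer_system G"
  proof (rule subrelI)
    fix L H assume LH: "(L, H) \<in> T"
    have "T \<subseteq> {H. subgroup H G} \<times> {H. subgroup H G}" and "L \<subseteq> H"
      using T LH by (simp_all add: transfer_system_def partial_order_on_def preorder_on_def)
    then show "(L, H) \<in> complete_transfer_system G"
      using LH by (auto simp: complete_transfer_system_def)
  qed
  show "complete_transfer_system G \<subseteq> T"
  proof (clarsimp simp: complete_transfer_system_def)
    fix L H assume "subgroup L G" and H: "subgroup H G" and LH: "L \<subseteq> H"
    then have "(L \<inter> H, carrier G \<inter> H) \<in> T"
      using T top[of L] subgroup.subset[OF H] unfolding transfer_system_def by blast
    moreover have "L \<inter> H = L" "carrier G \<inter> H = H"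
      using LH subgroup.subset[OF H] by auto
    ultimately show "(L, H) \<in> T" by simp
  qed
qed

text \<open>Restricting \<open>K \<rightarrow> G\<close> to \<open>L\<close> gives
  \<open>K \<inter> L \<rightarrow> L\<close>, which composes with
  \<open>L \<rightarrow> G\<close>.\<close>

lemma transfer_system_Int_top:
  assumes T: "transfer_system G T"
    and K: "(K, carrier G) \<in> T" "(L, carrier G) \<in> T"
  shows "(K \<inter> L, carrier G) \<in> T"
proof -
  have "T \<subseteq> {H. subgroup H G} \<times> {H. subgroup H G}" and tr: "trans T"
    using T by (simp_all add: transfer_system_def partial_order_on_def preorder_on_def)
  then have L: "subgroup L G" "L \<subseteq> carrier G"
    using K(2) subgroup.subset by auto
  have "(K \<inter> L, carrier G \<inter> L) \<in> T"
    using T K(1) L unfolding transfer_system_def by blast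
  moreover have "carrier G \<inter> L = L" using L by blast
  ultimately show ?thesis
    using K(2) tr by (metis transD)
qed

lemma transfer_system_conjugate_top:
  assumes T: "transfer_system G T" and K: "(K, carrier G) \<in> T" "conjugate_to K L"
  shows "(L, carrier G) \<in> T"
proof -
  obtain g where g: "g \<in> carrier G" "L = g <# K #> inv g"
    using K(2) by (auto simp: conjugate_to_def)
  have closed: "x <# carrier G #> inv x \<subseteq> carrier G" if "x \<in> carrier G" for x
    using that by (auto simp: conjugate_image)
  have "carrier G = g <# (inv g <# carrier G #> inv (inv g)) #> inv g"
    using conjugate_inv_conjugate(2)[OF g(1)] by simp
  also have "\<dots> \<subseteq> g <# carrier G #> inv g"
    using closed[of "inv g"] g(1) by (intro conjugate_mono) simp
  finally have "g <# carrier G #> inv g = carrier G"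
    using closed[OF g(1)] by blast
  then show ?thesis
    using T K(1) g unfolding transfer_system_def by metis
qed

text \<open>The assumption \<open>top\<close> ranges over all transfer systems, so that it applies
  to the one generated by the pairs \<open>(K, carrier G)\<close> without an explicit description of
  that system.\<close>

lemma width_eq_card_meet_irreducible:
  assumes fin: "finite R"
    and irr: "\<And>K. K \<in> R \<Longrightarrow> meet_irreducible K"
    and indep: "\<And>K L. K \<in> R \<Longrightarrow> L \<in> R \<Longrightarrow> conjugate_to K L \<Longrightarrow> K = L"
    and top: "\<And>T L. transfer_system G T \<Longrightarrow> (\<And>K. K \<in> R \<Longrightarrow> (K, carrier G) \<in> T) \<Longrightarrow>
      subgroup L G \<Longrightarrow> (L, carrier G) \<in> T"
  shows "width G = card R"
proof -
  have sub: "subgroup K G" "K \<subseteq> carrier G" if "K \<in> R" for K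
    using irr[OF that] subgroup.subset unfolding meet_irreducible_def by blast+
  show ?thesis
    unfolding width_def
  proof (rule Least_equality)
    let ?S = "(\<lambda>K. (K, carrier G)) ` R"
    have S: "?S \<subseteq> complete_transfer_system G"
      using sub by (simp add: complete_transfer_system_def subgroup_self image_subset_iff)
    have "generated_transfer_system G ?S = complete_transfer_system G"
    proof (rule transfer_system_eq_complete)
      show T: "transfer_system G (generated_transfer_system G ?S)"
        by (rule transfer_system_generated[OF S])
      show "(L, carrier G) \<in> generated_transfer_system G ?S" if "subgroup L G" for L
      proof (rule top[OF T _ that])
        show "(K, carrier G) \<in> generated_transfer_system G ?S" if "K \<in> R" for K
          using that unfolding generated_transfer_system_def by blast
      qed
    qed
    moreover have "card ?S = card R"
      by (intro card_image) (simp add: inj_on_def)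
    ultimately show "\<exists>S\<subseteq>complete_transfer_system G. finite S \<and> card S = card R \<and>
        generated_transfer_system G S = complete_transfer_system G"
      using S fin by (intro exI[of _ ?S]) simp
  next
    fix k assume "\<exists>S\<subseteq>complete_transfer_system G. finite S \<and> card S = k \<and>
        generated_transfer_system G S = complete_transfer_system G"
    then obtain S where S: "S \<subseteq> complete_transfer_system G" "finite S" "card S = k"
      "generated_transfer_system G S = complete_transfer_system G" by blast
    \<comment> \<open>Each \<open>K\<close> in \<open>R\<close> picks a pair of \<open>S\<close>
      whose source is conjugate to it. Two members sharing a pair would be conjugate, so the choice
      is injective.\<close>
    have "\<forall>K\<in>R. \<exists>p. p \<in> S \<and> conjugate_to K (fst p)"
      using meet_irreducible_source[OF irr S(1,4)] by (simp add: case_prod_beta Bex_def)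
    from bchoice[OF this] obtain f
      where f: "\<And>K. K \<in> R \<Longrightarrow> f K \<in> S \<and> conjugate_to K (fst (f K))"
      by blast
    have "inj_on f R"
    proof (rule inj_onI)
      fix K L assume KL: "K \<in> R" "L \<in> R" "f K = f L"
      have "conjugate_to K (fst (f K))" "conjugate_to (fst (f K)) L"
        using f[OF KL(1)] f[OF KL(2)] KL(3) conjugate_to_sym[OF _ sub(2)[OF KL(2)]] by simp_all
      then have "conjugate_to K L"
        by (rule conjugate_to_trans) (rule sub(2)[OF KL(1)])
      then show "K = L" using indep KL by blast
    qed
    moreover have "f ` R \<subseteq> S" using f by blast
    ultimately show "card R \<le> k"
      using card_inj_on_le S(2,3) by blast
  qed
qed

end


section \<open>Subgroups in coordinates\<close>

lemma two_power_dvd_iff: "(2::int) ^ k dvd 2 ^ m \<longleftrightarrow> k \<le> m"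
  by (simp add: dvd_power_iff)

lemma dvd_congruent: "(d::int) dvd i - j \<Longrightarrow> d dvd i \<longleftrightarrow> d dvd j"
  using dvd_add_right_iff[of d "i - j" j] by simp

section \<open>Arithmetic in the coordinates\<close>

text \<open>\<open>E i e\<close> stands for \<open>a^i b^e\<close>. Since \<open>2 ^ (n - 2)\<close> is even, the
  twist \<open>(1 + 2 ^ (n - 2)) ^ e\<close> agrees with \<open>1 + e * 2 ^ (n - 2)\<close> modulo \<open>2 ^ (n - 1)\<close>.\<close>

locale modular_coordinates = group G for G (structure) +
  fixes E :: "int \<Rightarrow> int \<Rightarrow> 'a" and n :: nat
  assumes n: "4 \<le> n"
    and carrier: "carrier G = {E i e | i e. True}"
    and mult: "E i e \<otimes> E j f = E (i + j + e * j * 2 ^ (n - 2)) (e + f)"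
    and eq_iff: "E i e = E j f \<longleftrightarrow> 2 ^ (n - 1) dvd i - j \<and> 2 dvd e - f"
begin

abbreviation h :: int where "h \<equiv> 2 ^ (n - 2)"

lemma N_eq: "2 ^ (n - 1) = 2 * h"
  using n by (simp flip: power_Suc add: Suc_diff_le numeral_eq_Suc)

lemma even_h: "2 dvd h" "4 dvd h"
  using n two_power_dvd_iff[of 1 "n - 2"] two_power_dvd_iff[of 2 "n - 2"] by simp_all

lemma in_carrier [simp]: "E i e \<in> carrier G"
  using carrier by blast

lemma one_eq: "\<one> = E 0 0"
  using mult[of 0 0 0 0] by (simp add: r_cancel_one')

lemma inv_eq: "inv (E i e) = E (e * i * h - i) (- e)"
  by (rule inv_equality) (simp_all add: mult one_eq)

text \<open>Commutators are powers of \<open>a^h\<close>, so conjugation changes the exponent of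
  \<open>a\<close> only by a multiple of \<open>h\<close>. Terms with \<open>h * h\<close> disappear
  because \<open>h\<close> is even and exponents of \<open>a\<close> count modulo
  \<open>2 * h\<close>.\<close>

lemma conjugate_eq:
  "E j f \<otimes> E i e \<otimes> inv (E j f) = E (i + h * (f * i + e * j)) e"
proof -
  obtain k where k: "h = 2 * k" using even_h(1) by blast
  have "j + i + f * i * h + (f * j * h - j) + (f + e) * (f * j * h - j) * h
      - (i + h * (f * i + e * j)) = (2 * h) * ((f + e) * f * j * k - e * j)"
    unfolding k by (simp add: algebra_simps)
  then show ?thesis
    unfolding inv_eq mult eq_iff N_eq by simp
qed

lemma coordinates_mod_two: "E i e = E i 0 \<or> E i e = E i 1"
  by (cases "even e") (auto simp: eq_iff)

lemma eq_if_coordinates: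
  assumes "H \<subseteq> carrier G" "K \<subseteq> carrier G"
    and "\<And>i. E i 0 \<in> H \<longleftrightarrow> E i 0 \<in> K" "\<And>i. E i 1 \<in> H \<longleftrightarrow> E i 1 \<in> K"
  shows "H = K"
proof -
  have "E i e \<in> H \<longleftrightarrow> E i e \<in> K" for i e
    using coordinates_mod_two[of i e] assms(3,4) by metis
  then show ?thesis
    using assms(1,2) unfolding carrier by blast
qed

section \<open>The three families of subgroups\<close>

definition A :: "'a set" where "A = {E i e | i e. 2 dvd e}"

definition D :: "nat \<Rightarrow> 'a set" where "D m = {E i e | i e. 2 ^ m dvd i}"

text \<open>One congruence covers two conditions: for even \<open>e\<close> that
  \<open>2^(m+1)\<close> divides \<open>i\<close>, for odd \<open>e\<close> that \<open>i\<close> is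
  an odd multiple of \<open>2^m\<close>.\<close>

definition B :: "nat \<Rightarrow> 'a set" where "B m = {E i e | i e. 2 ^ (m + 1) dvd i + e * 2 ^ m}"

lemma mem_A: "E i e \<in> A \<longleftrightarrow> 2 dvd e"
proof -
  have "2 dvd e \<longleftrightarrow> 2 dvd f" if "E i e = E j f" for j f
    using that by (intro dvd_congruent) (simp add: eq_iff)
  then show ?thesis unfolding A_def by blast
qed

text \<open>Coordinates are not unique, so the congruence must not depend on their choice. The bound
  on \<open>m\<close> makes its modulus divide \<open>2^(n-1)\<close>, the period of
  \<open>i\<close>; in \<open>mem_B\<close> the modulus is \<open>2^(m+1)\<close>, whence the
  smaller bound.\<close>

lemma mem_D:
  assumes "m \<le> n - 1"
  shows "E i e \<in> D m \<longleftrightarrow> 2 ^ m dvd i"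
proof -
  have "2 ^ m dvd i \<longleftrightarrow> 2 ^ m dvd j" if "E i e = E j f" for j f
    using that dvd_trans[of "2 ^ m" "2 ^ (n - 1)" "i - j"] assms
    by (intro dvd_congruent) (simp add: eq_iff two_power_dvd_iff)
  then show ?thesis unfolding D_def by blast
qed

lemma mem_B:
  assumes "m \<le> n - 2"
  shows "E i e \<in> B m \<longleftrightarrow> 2 ^ (m + 1) dvd i + e * 2 ^ m"
proof -
  have "2 ^ (m + 1) dvd i + e * 2 ^ m \<longleftrightarrow> 2 ^ (m + 1) dvd j + f * 2 ^ m" if "E i e = E j f" for j f
  proof (rule dvd_congruent)
    have "2 ^ (m + 1) dvd i - j"
      using that dvd_trans[of "2 ^ (m + 1)" "2 ^ (n - 1)" "i - j"] assms n
      unfolding eq_iff two_power_dvd_iff by auto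
    moreover have "2 ^ (m + 1) dvd (e - f) * 2 ^ m"
      using that by (simp add: eq_iff mult_dvd_mono)
    ultimately have "2 ^ (m + 1) dvd (i - j) + (e - f) * 2 ^ m" by (rule dvd_add)
    then show "2 ^ (m + 1) dvd (i + e * 2 ^ m) - (j + f * 2 ^ m)"
      by (simp add: algebra_simps)
  qed
  then show ?thesis unfolding B_def by blast
qed

lemma subset_carrier: "A \<subseteq> carrier G" "D m \<subseteq> carrier G" "B m \<subseteq> carrier G"
  by (auto simp: A_def D_def B_def)

lemma subgroup_coordinatesI:
  assumes "K \<subseteq> carrier G" "E 0 0 \<in> K"
    and "\<And>i e j f. E i e \<in> K \<Longrightarrow> E j f \<in> K \<Longrightarrow> E (i + j + e * j * h) (e + f) \<in> K"
    and "\<And>i e. E i e \<in> K \<Longrightarrow> E (e * i * h - i) (- e) \<in> K"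
  shows "subgroup K G"
proof (rule subgroupI)
  show "K \<subseteq> carrier G" "K \<noteq> {}" using assms(1,2) by auto
  have rep: "\<exists>i e. x = E i e" if "x \<in> K" for x
    using that assms(1) carrier by blast
  show "inv x \<in> K" if "x \<in> K" for x
    using rep[OF that] assms(4) that by (auto simp: inv_eq)
  show "x \<otimes> y \<in> K" if "x \<in> K" "y \<in> K" for x y
    using rep[OF that(1)] rep[OF that(2)] assms(3) that by (auto simp: mult)
qed

lemma subgroup_A: "subgroup A G"
  by (rule subgroup_coordinatesI) (auto simp: mem_A subset_carrier)

lemma subgroup_D: "m \<le> n - 1 \<Longrightarrow> subgroup (D m) G"
  by (rule subgroup_coordinatesI) (auto simp: mem_D subset_carrier)

lemma subgroup_B:
  assumes m: "m \<le> n - 2"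
  shows "subgroup (B m) G"
proof (rule subgroup_coordinatesI)
  \<comment> \<open>A member \<open>E j f\<close> has \<open>2^m\<close> dividing \<open>j\<close>,
    and \<open>h\<close> is even, so the twist term vanishes modulo \<open>2^(m+1)\<close>. Hence
    \<open>i + e * 2^m\<close> is additive under multiplication to that modulus.\<close>
  have twist: "2 ^ (m + 1) dvd e * j * h" if "2 ^ (m + 1) dvd j + f * 2 ^ m" for e j f
  proof -
    have "2 ^ m dvd j + f * 2 ^ m"
      using that by (rule dvd_trans[rotated]) simp
    then have "2 ^ m dvd j"
      by (simp add: dvd_add_left_iff)
    then have "2 ^ m * 2 dvd j * h"
      by (intro mult_dvd_mono even_h)
    then show ?thesis by (simp add: mult.assoc mult.commute)
  qed
  show "B m \<subseteq> carrier G" "E 0 0 \<in> B m"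
    using m by (simp_all add: subset_carrier mem_B)
  show "E (i + j + e * j * h) (e + f) \<in> B m" if "E i e \<in> B m" "E j f \<in> B m" for i e j f
  proof -
    have "2 ^ (m + 1) dvd (i + e * 2 ^ m) + (j + f * 2 ^ m) + e * j * h"
      using that twist unfolding mem_B[OF m] by (intro dvd_add[OF dvd_add]) blast+
    then show ?thesis unfolding mem_B[OF m] by (simp only: algebra_simps)
  qed
  show "E (e * i * h - i) (- e) \<in> B m" if "E i e \<in> B m" for i e
  proof -
    have "2 ^ (m + 1) dvd e * i * h - (i + e * 2 ^ m)"
      using that twist[of i e e] unfolding mem_B[OF m] by (intro dvd_diff)
    moreover have "e * i * h - (i + e * 2 ^ m) = e * i * h - i + - e * 2 ^ m"
      by simp
    ultimately show ?thesis unfolding mem_B[OF m] by (simp only:)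
  qed
qed

section \<open>Classification of the subgroups\<close>

lemma power_closed:
  assumes H: "subgroup H G" and i: "E i 0 \<in> H"
  shows "E (x * i) 0 \<in> H"
proof -
  have pos: "E (int k * i) 0 \<in> H" for k
  proof (induction k)
    case 0
    show ?case using subgroup.one_closed[OF H] by (simp add: one_eq)
  next
    case (Suc k)
    have "E (int k * i) 0 \<otimes> E i 0 \<in> H"
      by (rule subgroup.m_closed[OF H Suc.IH i])
    then show ?case by (simp add: mult algebra_simps)
  qed
  show ?thesis
  proof (cases "x \<ge> 0")
    case True
    then show ?thesis using pos[of "nat x"] by simp
  next
    case False
    then show ?thesis
      using subgroup.m_inv_closed[OF H pos[of "nat (- x)"]] by (simp add: inv_eq)
  qed
qed

text \<open>By Bezout, \<open>H\<close> contains the power of \<open>a\<close> whose exponent is the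
  gcd of \<open>i\<close> and \<open>2^(n-1)\<close>. This gcd is a power of 2, so the smallest
  power of 2 among the exponents in \<open>H\<close> divides all of them.\<close>

lemma cyclic_part:
  assumes H: "subgroup H G"
  obtains m where "m \<le> n - 1" "\<And>i. E i 0 \<in> H \<longleftrightarrow> 2 ^ m dvd i"
proof -
  have N: "E (2 ^ (n - 1)) 0 \<in> H"
    using subgroup.one_closed[OF H] eq_iff[of "2 ^ (n - 1)" 0 0 0] by (simp add: one_eq)
  define m where "m = (LEAST m. E (2 ^ m) 0 \<in> H)"
  have m: "E (2 ^ m) 0 \<in> H" "m \<le> k" if "E (2 ^ k) 0 \<in> H" for k
    unfolding m_def using that by (auto intro: LeastI Least_le)
  have "2 ^ m dvd i" if i: "E i 0 \<in> H" for i
  proof -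
    obtain k where "normalize (gcd i (2 ^ (n - 1))) = 2 ^ k"
      using divides_primepow[of 2 "gcd i (2 ^ (n - 1))" "n - 1"] by auto
    then have k: "gcd i (2 ^ (n - 1)) = 2 ^ k" by simp
    obtain x y where "x * i + y * 2 ^ (n - 1) = gcd i (2 ^ (n - 1))"
      using bezout_int by blast
    then have "E (2 ^ k) 0 = E (x * i) 0 \<otimes> E (y * 2 ^ (n - 1)) 0"
      by (simp add: mult flip: k)
    also have "\<dots> \<in> H"
      by (intro subgroup.m_closed[OF H] power_closed H i N)
    finally have "(2::int) ^ m dvd 2 ^ k"
      using m(2) by (simp add: two_power_dvd_iff)
    then show ?thesis
      using k by (metis dvd_trans gcd_dvd1)
  qed
  moreover have "E i 0 \<in> H" if "2 ^ m dvd i" for i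
    using that power_closed[OF H m(1)[OF N]] by (auto simp: dvd_def mult.commute)
  ultimately show thesis
    using that m(2)[OF N] by blast
qed

text \<open>If \<open>H\<close> is not inside \<open>\<langle>a\<rangle>\<close>, its elements
  outside form one coset of \<open>H \<inter> \<langle>a\<rangle>\<close>, with exponents congruent
  to some \<open>s\<close> modulo \<open>2^m\<close>. Squaring forces \<open>2^m\<close> to divide
  \<open>2 * s\<close>, which leaves \<open>s\<close> congruent to 0, giving \<open>D m\<close>, or
  to \<open>2^(m-1)\<close>, giving \<open>B (m - 1)\<close>.\<close>

lemma subgroup_cases:
  assumes H: "subgroup H G"
  obtains (A) m where "m \<le> n - 1" "H = A \<inter> D m"
  | (D) m where "m \<le> n - 1" "H = D m"
  | (B) m where "m \<le> n - 2" "H = B m"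
proof -
  obtain m where m: "m \<le> n - 1" and cyclic: "\<And>i. E i 0 \<in> H \<longleftrightarrow> 2 ^ m dvd i"
    using cyclic_part[OF H] by blast
  have HG: "H \<subseteq> carrier G" using H by (rule subgroup.subset)
  show thesis
  proof (cases "\<exists>s. E s 1 \<in> H")
    case False
    have "H = A \<inter> D m"
      using False m by (intro eq_if_coordinates HG) (use subset_carrier in \<open>auto simp: cyclic mem_A mem_D\<close>)
    then show ?thesis using A m by blast
  next
    case True
    then obtain s where s: "E s 1 \<in> H" by blast
    have coset: "E i 1 \<in> H \<longleftrightarrow> 2 ^ m dvd i - s" for i
    proof -
      have "E i 1 = E (i - s) 0 \<otimes> E s 1" by (simp add: mult)
      moreover have "x \<in> H" if "x \<otimes> y \<in> H" "y \<in> H" "x \<in> carrier G" for x y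
      proof -
        have "y \<in> carrier G" using that(2) HG by blast
        then have "x = x \<otimes> y \<otimes> inv y" using that(3) by (simp add: m_assoc)
        then show ?thesis
          using subgroup.m_closed[OF H that(1) subgroup.m_inv_closed[OF H that(2)]] by simp
      qed
      ultimately show ?thesis
        using s cyclic[of "i - s"] subgroup.m_closed[OF H] by (metis in_carrier)
    qed
    have "E (s * (2 + h)) 0 = E s 1 \<otimes> E s 1"
      by (simp add: mult eq_iff algebra_simps)
    then have "2 ^ m dvd s * (2 + h)"
      using subgroup.m_closed[OF H s s] cyclic by metis
    \<comment> \<open>Since 4 divides \<open>h\<close>, the factor \<open>2 + h\<close> is twice an
      odd number, and the odd part can be cancelled modulo \<open>2^m\<close>.\<close>
    moreover obtain q where q: "h = 4 * q" using even_h(2) by blast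
    have "coprime ((2::int) ^ m) (1 + 2 * q)"
      by simp
    moreover have "s * (2 + h) = (2 * s) * (1 + 2 * q)"
      by (simp add: q algebra_simps)
    ultimately have sq: "2 ^ m dvd 2 * s"
      by (metis coprime_dvd_mult_left_iff)
    consider "2 ^ m dvd s" | k where "m = Suc k" "\<not> 2 ^ m dvd s"
      by (cases m) auto
    then show ?thesis
    proof cases
      case 1
      then have "E i 1 \<in> H \<longleftrightarrow> 2 ^ m dvd i" for i
        using coset by (simp add: dvd_diff_left_iff)
      then have "H = D m"
        using m by (intro eq_if_coordinates HG) (auto simp: subset_carrier cyclic mem_D)
      then show ?thesis using D m by blast
    next
      case 2
      have k: "k \<le> n - 2" using m 2(1) by simp
      obtain t where t: "s = 2 ^ k * t" using sq 2(1) by (auto simp: dvd_def)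
      have "odd t" using 2 by (auto simp: t)
      \<comment> \<open>With \<open>t\<close> odd, \<open>s\<close> is congruent to
        \<open>2^k\<close> and hence to \<open>-2^k\<close> modulo \<open>2^(k+1)\<close>; this sign
        matches \<open>mem_B\<close> for \<open>e = 1\<close>.\<close>
      then have "2 ^ m dvd i - s \<longleftrightarrow> 2 ^ m dvd i + 2 ^ k" for i
        by (intro dvd_congruent) (auto simp: t 2(1) algebra_simps elim!: oddE)
      then have "H = B k"
        using coset k 2(1)
        by (intro eq_if_coordinates HG) (auto simp: subset_carrier cyclic mem_B)
      then show ?thesis using B k by blast
    qed
  qed
qed

section \<open>Least proper overgroups\<close>

lemma D_subset: "k \<le> m \<Longrightarrow> D m \<subseteq> D k"
  unfolding D_def using le_imp_power_dvd[of k m "2::int"] by (blast intro: dvd_trans)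

lemma B_subset_D: "B m \<subseteq> D m"
proof -
  have "2 ^ m dvd i" if "2 ^ (m + 1) dvd i + e * 2 ^ m" for i e :: int
  proof -
    have "2 ^ m dvd i + e * 2 ^ m"
      using that by (rule dvd_trans[rotated]) simp
    then show ?thesis by (simp add: dvd_add_left_iff)
  qed
  then show ?thesis unfolding B_def D_def by blast
qed

lemma D_zero: "D 0 = carrier G"
  unfolding D_def carrier by simp

text \<open>\<open>\<langle>a\<rangle>\<close> is maximal: an overgroup contains \<open>a\<close>,
  which lies in no \<open>B m\<close> and in no \<open>D m\<close> with \<open>m\<close>
  positive.\<close>

lemma meet_irreducible_A: "meet_irreducible A"
  unfolding meet_irreducible_def
proof (intro conjI exI[of _ "D 0"] allI impI)
  show "subgroup A G" "subgroup (D 0) G"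
    by (simp_all add: subgroup_A subgroup_D)
  show "A \<subset> D 0"
    using subset_carrier(1) mem_A[of 0 1] by (auto simp: D_zero)
  fix H assume H: "subgroup H G \<and> A \<subset> H"
  then have a: "E 1 0 \<in> H" using mem_A[of 1 0] by auto
  from H have "subgroup H G" by blast
  then show "D 0 \<subseteq> H"
  proof (cases rule: subgroup_cases)
    case (A m)
    then show ?thesis using H by blast
  next
    case (D m)
    then have "m = 0" using a two_power_dvd_iff[of m 0] by (simp add: mem_D)
    then show ?thesis using D by simp
  next
    case (B m)
    then show ?thesis using a two_power_dvd_iff[of "m + 1" 0] by (simp add: mem_B)
  qed
qed

text \<open>The subgroups containing \<open>b\<close> are exactly the \<open>D k\<close>, which form
  a chain; directly above \<open>D m\<close> comes \<open>D (m - 1)\<close>.\<close>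

lemma meet_irreducible_D:
  assumes m: "1 \<le> m" "m \<le> n - 1"
  shows "meet_irreducible (D m)"
  unfolding meet_irreducible_def
proof (intro conjI exI[of _ "D (m - 1)"] allI impI)
  show "subgroup (D m) G" "subgroup (D (m - 1)) G"
    using m by (simp_all add: subgroup_D)
  have "E (2 ^ (m - 1)) 0 \<in> D (m - 1)" "E (2 ^ (m - 1)) 0 \<notin> D m"
    using m by (simp_all add: mem_D two_power_dvd_iff)
  then show "D m \<subset> D (m - 1)"
    using D_subset[of "m - 1" m] by auto
  fix H assume H: "subgroup H G \<and> D m \<subset> H"
  moreover have "E 0 1 \<in> D m" "E (2 ^ m) 0 \<in> D m"
    using m by (simp_all add: mem_D)
  ultimately have b: "E 0 1 \<in> H" and a: "E (2 ^ m) 0 \<in> H"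
    by blast+
  from H have "subgroup H G" by blast
  then show "D (m - 1) \<subseteq> H"
  proof (cases rule: subgroup_cases)
    case (A k)
    then show ?thesis using b by (simp add: mem_A)
  next
    case (D k)
    then have "k \<le> m" using a by (simp add: mem_D two_power_dvd_iff)
    moreover have "k \<noteq> m" using D H by blast
    ultimately show ?thesis using D D_subset[of k "m - 1"] by simp
  next
    case (B k)
    then show ?thesis using b two_power_dvd_iff[of "k + 1" k] by (simp add: mem_B)
  qed
qed

text \<open>The proper overgroups of \<open>B m\<close> are the \<open>D k\<close> with
  \<open>k \<le> m\<close>. A different \<open>B k\<close> is ruled out because the 2-adic valuation
  of \<open>2^m + 2^k\<close> is then the smaller of \<open>m\<close> and \<open>k\<close>, so
  \<open>2^(k+1)\<close> does not divide it.\<close>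

lemma meet_irreducible_B:
  assumes m: "m \<le> n - 2"
  shows "meet_irreducible (B m)"
  unfolding meet_irreducible_def
proof (intro conjI exI[of _ "D m"] allI impI)
  show "subgroup (B m) G" "subgroup (D m) G"
    using m by (simp_all add: subgroup_B subgroup_D)
  have "E (2 ^ m) 0 \<in> D m" "E (2 ^ m) 0 \<notin> B m"
    using m two_power_dvd_iff[of "m + 1" m] by (simp_all add: mem_D mem_B)
  then show "B m \<subset> D m"
    using B_subset_D[of m] by auto
  fix H assume H: "subgroup H G \<and> B m \<subset> H"
  moreover have "E (2 ^ m) 1 \<in> B m"
    using m by (simp add: mem_B)
  ultimately have ab: "E (2 ^ m) 1 \<in> H"
    by blast
  from H have "subgroup H G" by blast
  then show "D m \<subseteq> H"
  proof (cases rule: subgroup_cases)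
    case (A k)
    then show ?thesis using ab by (simp add: mem_A)
  next
    case (D k)
    then show ?thesis using D_subset[of k m] ab by (simp add: mem_D two_power_dvd_iff)
  next
    case (B k)
    then have k: "(2::int) ^ (k + 1) dvd 2 ^ m + 2 ^ k"
      using ab by (simp add: mem_B)
    have "m \<noteq> k" using B H by blast
    then consider "m < k" | "k < m" by linarith
    then have False
    proof cases
      case 1
      have "(2::int) ^ (m + 1) dvd 2 ^ m + 2 ^ k"
        using 1 by (intro dvd_trans[OF _ k]) (simp only: two_power_dvd_iff)
      moreover have "(2::int) ^ (m + 1) dvd 2 ^ k"
        using 1 by (simp only: two_power_dvd_iff)
      ultimately have "(2::int) ^ (m + 1) dvd 2 ^ m"
        by (simp only: dvd_add_left_iff)
      then show ?thesis unfolding two_power_dvd_iff by simp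
    next
      case 2
      then have "(2::int) ^ (k + 1) dvd 2 ^ m"
        unfolding two_power_dvd_iff by simp
      then have "(2::int) ^ (k + 1) dvd 2 ^ k"
        using k by (simp only: dvd_add_right_iff)
      then show ?thesis unfolding two_power_dvd_iff by simp
    qed
    then show ?thesis ..
  qed
qed

section \<open>Conjugacy between the families\<close>

lemma conjugate_D_B: "conjugate_to (D (n - 1)) (B (n - 2))"
proof -
  \<comment> \<open>\<open>D (n - 1)\<close> is \<open>\<langle>b\<rangle>\<close>, and conjugation
    by \<open>a\<close> sends \<open>b\<close> to \<open>a^h b\<close>, the generator of
    \<open>B (n - 2)\<close>.\<close>
  have "E 1 0 <# D (n - 1) #> inv (E 1 0) = {E (i + h * e) e | i e. 2 ^ (n - 1) dvd i}"
  proof -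
    have "E 1 0 <# D (n - 1) #> inv (E 1 0)
        = {E 1 0 \<otimes> E i e \<otimes> inv (E 1 0) | i e. 2 ^ (n - 1) dvd i}"
      unfolding conjugate_image D_def by blast
    then show ?thesis unfolding conjugate_eq by simp
  qed
  also have "\<dots> = B (n - 2)"
  proof (intro equalityI subsetI)
    fix x assume "x \<in> {E (i + h * e) e | i e. 2 ^ (n - 1) dvd i}"
    then obtain i e where "x = E (i + h * e) e" "2 * h dvd i"
      unfolding N_eq by blast
    moreover have "i + h * e + e * h = i + (2 * h) * e" by simp
    ultimately show "x \<in> B (n - 2)"
      by (simp add: mem_B dvd_add)
  next
    fix x assume "x \<in> B (n - 2)"
    then obtain i e where x: "x = E i e" "2 * h dvd i + e * h"
      unfolding B_def by auto
    moreover have "i + e * h = i - h * e + (2 * h) * e" by simp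
    ultimately have "2 * h dvd i - h * e"
      by (metis dvd_add_left_iff dvd_triv_left)
    moreover have "x = E (i - h * e + h * e) e" using x by simp
    ultimately show "x \<in> {E (i + h * e) e | i e. 2 ^ (n - 1) dvd i}"
      unfolding N_eq by blast
  qed
  finally show ?thesis
    unfolding conjugate_to_def by (metis in_carrier)
qed

text \<open>A subgroup containing \<open>a^h\<close> is normal, because conjugation multiplies
  elements only by powers of \<open>a^h\<close>.\<close>

lemma conjugate_to_subset:
  assumes KL: "conjugate_to K L" and K: "subgroup K G" and c: "E h 0 \<in> K"
  shows "L \<subseteq> K"
proof
  fix y assume "y \<in> L"
  then obtain g x where g: "g \<in> carrier G" and x: "x \<in> K" "y = g \<otimes> x \<otimes> inv g"
    using KL unfolding conjugate_to_def conjugate_image by blast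
  obtain j f where gE: "g = E j f" using g carrier by blast
  obtain i e where xE: "x = E i e" using x(1) carrier subgroup.subset[OF K] by blast
  have "y = E (i + h * (f * i + e * j)) e"
    unfolding x(2) gE xE by (rule conjugate_eq)
  then have "y = E ((f * i + e * j) * h) 0 \<otimes> E i e"
    unfolding mult by (simp add: algebra_simps)
  then show "y \<in> K"
    using power_closed[OF K c] x(1) xE subgroup.m_closed[OF K] by metis
qed

text \<open>\<open>a^h\<close> is central: conjugation changes its exponent by a multiple of
  \<open>h * h\<close>, which \<open>2 * h\<close> divides as \<open>h\<close> is even.\<close>

lemma conjugate_to_central:
  assumes KL: "conjugate_to K L" and c: "E h 0 \<in> K"
  shows "E h 0 \<in> L"
proof -
  obtain g where g: "g \<in> carrier G" "L = g <# K #> inv g"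
    using KL unfolding conjugate_to_def by blast
  obtain j f where gE: "g = E j f" using g carrier by blast
  obtain k where k: "h = 2 * k" using even_h(1) by blast
  have "h + h * (f * h + 0 * j) - h = (2 * h) * (f * k)"
    unfolding k by simp
  then have "2 * h dvd h + h * (f * h + 0 * j) - h"
    by (metis dvd_triv_left)
  then have "g \<otimes> E h 0 \<otimes> inv g = E h 0"
    unfolding gE conjugate_eq eq_iff N_eq by (intro conjI) simp_all
  then show ?thesis
    using c unfolding g(2) conjugate_image by (metis imageI)
qed

section \<open>Representatives and their number\<close>

definition representatives :: "'a set set" where
  "representatives = insert A (D ` {1..n - 1} \<union> B ` {..<n - 2})"

lemma representatives_cases:
  assumes "K \<in> representatives"
  shows "E h 0 \<in> K \<or> K = D (n - 1)"
proof -
  have "E h 0 \<in> D m \<or> D m = D (n - 1)" if "m \<le> n - 1" for m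
    using that by (cases "m = n - 1") (auto simp: mem_D two_power_dvd_iff)
  moreover have "E h 0 \<in> B m" if "m < n - 2" for m
    using that two_power_dvd_iff[of "m + 1" "n - 2"] by (simp add: mem_B)
  ultimately show ?thesis
    using assms mem_A[of h 0] unfolding representatives_def by fastforce
qed

lemma meet_irreducible_representatives:
  "K \<in> representatives \<Longrightarrow> meet_irreducible K"
  using meet_irreducible_A meet_irreducible_B meet_irreducible_D
  by (auto simp: representatives_def)

text \<open>All representatives but \<open>D (n - 1)\<close> contain the central \<open>a^h\<close>.
  They are therefore normal, hence alone in their classes, and \<open>D (n - 1)\<close> is conjugate
  to none of them.\<close>

lemma representatives_not_conjugate:
  assumes K: "K \<in> representatives" and L: "L \<in> representatives" and KL: "conjugate_to K L"
  shows "K = L"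
proof -
  have sub: "subgroup K G" "subgroup L G"
    using meet_irreducible_representatives K L by (simp_all add: meet_irreducible_def)
  then have LK: "conjugate_to L K"
    using conjugate_to_sym[OF KL] subgroup.subset by blast
  show ?thesis
  proof (cases "E h 0 \<in> K")
    case True
    then show ?thesis
      using conjugate_to_subset conjugate_to_central KL LK sub by blast
  next
    case False
    then have "E h 0 \<notin> L" using conjugate_to_central LK by blast
    then show ?thesis using False representatives_cases K L by blast
  qed
qed

text \<open>The families contribute 1, \<open>n - 1\<close> and \<open>n - 2\<close> subgroups:
  \<open>D 0\<close> is left out as the whole group, \<open>B (n - 2)\<close> as a conjugate of
  \<open>D (n - 1)\<close>. The element \<open>b\<close> separates the \<open>D k\<close> from the
  rest, and \<open>a\<close> separates \<open>A\<close> from the \<open>B m\<close>.\<close>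

lemma card_representatives: "card representatives = 2 * (n - 1)"
proof -
  have "inj_on D {1..n - 1}"
  proof (rule inj_onI)
    fix m k assume mk: "m \<in> {1..n - 1}" "k \<in> {1..n - 1}" "D m = D k"
    have "E (2 ^ m) 0 \<in> D m" "E (2 ^ k) 0 \<in> D k"
      using mk(1,2) by (simp_all add: mem_D)
    then have "(2::int) ^ m dvd 2 ^ k" "(2::int) ^ k dvd 2 ^ m"
      using mk mem_D[of k "2 ^ m" 0] mem_D[of m "2 ^ k" 0] by auto
    then show "m = k" unfolding two_power_dvd_iff by simp
  qed
  moreover have "inj_on B {..<n - 2}"
  proof (rule inj_onI)
    fix m k assume mk: "m \<in> {..<n - 2}" "k \<in> {..<n - 2}" "B m = B k"
    have "E (2 ^ (m + 1)) 0 \<in> B m" "E (2 ^ (k + 1)) 0 \<in> B k"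
      using mk(1,2) by (simp_all add: mem_B)
    then have "(2::int) ^ (m + 1) dvd 2 ^ (k + 1)" "(2::int) ^ (k + 1) dvd 2 ^ (m + 1)"
      using mk mem_B[of k "2 ^ (m + 1)" 0] mem_B[of m "2 ^ (k + 1)" 0] by auto
    then show "m = k" unfolding two_power_dvd_iff by simp
  qed
  moreover have "A \<noteq> D m" if "m \<in> {1..n - 1}" for m
    using mem_A[of 0 1] mem_D[of m 0 1] that by auto
  moreover have "A \<noteq> B m" if "m \<in> {..<n - 2}" for m
    using mem_A[of 1 0] mem_B[of m 1 0] that two_power_dvd_iff[of "m + 1" 0] by auto
  moreover have "D k \<noteq> B m" if "k \<in> {1..n - 1}" "m \<in> {..<n - 2}" for k m
    using mem_D[of k 0 1] mem_B[of m 0 1] that two_power_dvd_iff[of "m + 1" m] by auto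
  ultimately have "A \<notin> D ` {1..n - 1}" "A \<notin> B ` {..<n - 2}"
    "D ` {1..n - 1} \<inter> B ` {..<n - 2} = {}"
    "card (D ` {1..n - 1}) = card {1..n - 1}" "card (B ` {..<n - 2}) = card {..<n - 2}"
    using card_image by blast+
  then show ?thesis
    using n by (simp add: representatives_def card_Un_disjoint)
qed

lemma width_eq: "width G = 2 * (n - 1)"
  unfolding card_representatives[symmetric]
proof (rule width_eq_card_meet_irreducible)
  show "finite representatives" by (simp add: representatives_def)
  show "meet_irreducible K" if "K \<in> representatives" for K
    using that by (rule meet_irreducible_representatives)
  show "K = L" if "K \<in> representatives" "L \<in> representatives" "conjugate_to K L" for K L
    using that by (rule representatives_not_conjugate)
  fix T H assume T: "transfer_system G T"
    and R: "\<And>K. K \<in> representatives \<Longrightarrow> (K, carrier G) \<in> T"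
    and H: "subgroup H G"
  \<comment> \<open>The indices outside \<open>representatives\<close> need other rules:
    \<open>D 0\<close> uses reflexivity, and \<open>B (n - 2)\<close> below uses conjugation from
    \<open>D (n - 1)\<close>.\<close>
  have D: "(D m, carrier G) \<in> T" if "m \<le> n - 1" for m
  proof (cases "m = 0")
    case True
    have "refl_on {H. subgroup H G} T"
      using T by (simp add: transfer_system_def partial_order_on_def preorder_on_def)
    then show ?thesis
      using True by (auto simp: D_zero refl_on_def subgroup_self)
  next
    case False
    then show ?thesis using R that by (simp add: representatives_def)
  qed
  have B: "(B m, carrier G) \<in> T" if "m \<le> n - 2" for m
  proof (cases "m = n - 2")
    case True
    then show ?thesis
      using transfer_system_conjugate_top[OF T D[of "n - 1"] conjugate_D_B] by simp
  next
    case False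
    then show ?thesis using R that by (simp add: representatives_def)
  qed
  show "(H, carrier G) \<in> T"
    using H
  proof (cases rule: subgroup_cases)
    case (A m)
    then show ?thesis
      using transfer_system_Int_top[OF T R D[of m]] by (simp add: representatives_def)
  next
    case (D m)
    then show ?thesis using \<open>\<And>m. m \<le> n - 1 \<Longrightarrow> (D m, carrier G) \<in> T\<close> by simp
  next
    case (B m)
    then show ?thesis using \<open>\<And>m. m \<le> n - 2 \<Longrightarrow> (B m, carrier G) \<in> T\<close> by simp
  qed
qed

end


section \<open>Normal forms of words\<close>

text \<open>Integer exponents \<open>(i, e)\<close> with \<open>w = a^i b^e\<close>. They are well defined on the group only up to
  \<open>exp_cong\<close>, which shows that different normal forms are different elements.\<close>

fun exponents :: "int \<Rightarrow> two_gens word \<Rightarrow> int \<times> int" where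
  "exponents c [] = (0, 0)"
| "exponents c ((Gen_a, s) # w) =
     (fst (exponents c w) + (if s then 1 else - 1), snd (exponents c w))"
| "exponents c ((Gen_b, s) # w) =
     ((1 + c) * fst (exponents c w), snd (exponents c w) + (if s then 1 else - 1))"

definition exp_mult :: "int \<Rightarrow> int \<times> int \<Rightarrow> int \<times> int \<Rightarrow> int \<times> int" where
  "exp_mult c p q = (fst p + fst q + snd p * fst q * c, snd p + snd q)"

definition exp_cong :: "int \<Rightarrow> int \<times> int \<Rightarrow> int \<times> int \<Rightarrow> bool" where
  "exp_cong c p q \<longleftrightarrow> 2 * c dvd fst p - fst q \<and> 2 dvd snd p - snd q"

lemma exp_cong_refl: "exp_cong c p p"
  by (simp add: exp_cong_def)

lemma exp_cong_sym: "exp_cong c p q \<Longrightarrow> exp_cong c q p"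
  by (simp add: exp_cong_def dvd_diff_commute)

lemma exp_cong_trans:
  assumes "exp_cong c p q" "exp_cong c q r"
  shows "exp_cong c p r"
  using assms dvd_add[of "2 * c" "fst p - fst q" "fst q - fst r"]
    dvd_add[of 2 "snd p - snd q" "snd q - snd r"]
  by (simp add: exp_cong_def)

lemma exp_cong_mult:
  assumes "exp_cong c p p'" "exp_cong c q q'"
  shows "exp_cong c (exp_mult c p q) (exp_mult c p' q')"
proof -
  obtain k l x y where eqs: "fst p = fst p' + 2 * c * k" "snd p = snd p' + 2 * l"
      "fst q = fst q' + 2 * c * x" "snd q = snd q' + 2 * y"
    using assms unfolding exp_cong_def dvd_def by (metis add.commute diff_add_cancel)
  have "fst (exp_mult c p q) - fst (exp_mult c p' q')
      = (2 * c) * (k + x + l * fst q' + snd p' * c * x + 2 * l * c * x)"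
    unfolding exp_mult_def eqs by (simp add: algebra_simps)
  moreover have "snd (exp_mult c p q) - snd (exp_mult c p' q') = 2 * (l + y)"
    unfolding exp_mult_def eqs by simp
  ultimately show ?thesis
    unfolding exp_cong_def by (metis dvd_triv_left)
qed

text \<open>In \<open>exponents\<close>, a letter \<open>Gen_b\<close> of either sign multiplies the
  exponent of \<open>a\<close> by \<open>1 + c\<close>, which for even \<open>c\<close> is its own
  inverse modulo \<open>2 * c\<close>. Concatenation therefore matches \<open>exp_mult\<close> only
  up to congruence.\<close>

lemma exponents_append:
  assumes "even c"
  shows "exp_cong c (exponents c (u @ v)) (exp_mult c (exponents c u) (exponents c v))"
proof (induction u)
  case Nil
  show ?case by (simp add: exp_mult_def exp_cong_refl)
next
  case (Cons x u)
  obtain g s where x: "x = (g, s)" by (cases x)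
  obtain i e j f where uv: "exponents c u = (i, e)" "exponents c v = (j, f)"
    by fastforce
  obtain k where k: "c = 2 * k" using assms by blast
  have IH: "2 * c dvd fst (exponents c (u @ v)) - (i + j + e * j * c)"
    "2 dvd snd (exponents c (u @ v)) - (e + f)"
    using Cons.IH by (simp_all add: exp_cong_def exp_mult_def uv)
  show ?case
  proof (cases g)
    case Gen_a
    then show ?thesis
      using IH by (simp add: x uv exp_cong_def exp_mult_def algebra_simps)
  next
    case Gen_b
    define t :: int where "t = (if s then 1 else - 1)"
    let ?d = "fst (exponents c (u @ v)) - (i + j + e * j * c)"
    \<comment> \<open>The error beyond the induction hypothesis is \<open>c^2 * e * j\<close>, a
      multiple of \<open>2 * c\<close> as \<open>c\<close> is even, plus
      \<open>c * j * (1 - t)\<close>, which is 0 or \<open>2 * c * j\<close>.\<close>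
    have "(1 + c) * fst (exponents c (u @ v)) - ((1 + c) * i + j + (e + t) * j * c)
        = (1 + c) * ?d + 2 * c * (e * j * k + (if s then 0 else j))"
      by (cases s) (simp_all add: t_def k algebra_simps)
    moreover have "2 * c dvd \<dots>"
      using IH(1) by (intro dvd_add dvd_mult dvd_triv_left)
    ultimately have "2 * c dvd (1 + c) * fst (exponents c (u @ v))
        - ((1 + c) * i + j + (e + t) * j * c)" by simp
    moreover have "2 dvd snd (exponents c (u @ v)) + t - (e + t + f)"
      using IH(2) by (simp add: algebra_simps)
    ultimately show ?thesis
      using Gen_b by (simp add: x uv exp_cong_def exp_mult_def t_def)
  qed
qed

lemma exponents_surj: "\<exists>w. exponents c w = (i, e)"
proof -
  \<comment> \<open>The \<open>b\<close> letters are placed first: their factor \<open>1 + c\<close>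
    fixes the exponent 0, and prepending \<open>a\<close> letters afterwards leaves \<open>e\<close>
    alone.\<close>
  have "\<exists>w. exponents c w = (0, e)"
  proof (induction e rule: int_induct[of _ 0])
    case base
    show ?case by (rule exI[of _ "[]"]) simp
  next
    case (step1 e)
    then obtain w where "exponents c w = (0, e)" by blast
    then show ?case by (intro exI[of _ "(Gen_b, True) # w"]) simp
  next
    case (step2 e)
    then obtain w where "exponents c w = (0, e)" by blast
    then show ?case by (intro exI[of _ "(Gen_b, False) # w"]) simp
  qed
  then show ?thesis
  proof (induction i rule: int_induct[of _ 0])
    case base
    then show ?case .
  next
    case (step1 i)
    then obtain w where "exponents c w = (i, e)" by blast
    then show ?case by (intro exI[of _ "(Gen_a, True) # w"]) simp
  next
    case (step2 i)
    then obtain w where "exponents c w = (i, e)" by blast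
    then show ?case by (intro exI[of _ "(Gen_a, False) # w"]) simp
  qed
qed


section \<open>Exponents respect the relations\<close>

definition modular_relations :: "nat \<Rightarrow> (two_gens word \<times> two_gens word) set" where
  "modular_relations n =
     {(replicate (2 ^ (n - 1)) (Gen_a, True), []),
      ([(Gen_b, True), (Gen_b, True)], []),
      ([(Gen_b, True), (Gen_a, True), (Gen_b, False)], replicate (1 + 2 ^ (n - 2)) (Gen_a, True))}"

lemma modular_group_eq: "modular_group n = presented_group (modular_relations n)"
  unfolding modular_group_def modular_relations_def Let_def ..

lemma exponents_replicate: "exponents c (replicate k (Gen_a, True)) = (int k, 0)"
  by (induction k) simp_all

text \<open>Each rule of \<open>word_eq\<close> preserves the exponents up to
  \<open>exp_cong\<close>, so they are an invariant of the group element. This bounds the presented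
  group from below: distinct normal forms do not collapse.\<close>

lemma exponents_word_eq:
  assumes n: "4 \<le> n" and uv: "word_eq (modular_relations n) u v"
  shows "exp_cong (2 ^ (n - 2)) (exponents (2 ^ (n - 2)) u) (exponents (2 ^ (n - 2)) v)"
proof -
  define c :: int where "c = 2 ^ (n - 2)"
  have N: "2 ^ (n - 1) = 2 * c"
    unfolding c_def using n by (simp flip: power_Suc add: Suc_diff_le numeral_eq_Suc)
  have "even c" unfolding c_def using n by simp
  from uv have "exp_cong c (exponents c u) (exponents c v)"
  proof (induction rule: word_eq.induct)
    case (relation u v)
    then consider "u = replicate (2 ^ (n - 1)) (Gen_a, True)" "v = []"
      | "u = [(Gen_b, True), (Gen_b, True)]" "v = []"
      | "u = [(Gen_b, True), (Gen_a, True), (Gen_b, False)]"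
        "v = replicate (1 + 2 ^ (n - 2)) (Gen_a, True)"
      by (auto simp: modular_relations_def)
    then show ?case
    proof cases
      case 1
      then show ?thesis by (simp only: exponents_replicate) (simp add: exp_cong_def flip: N)
    next
      case 2
      then show ?thesis by (simp add: exp_cong_def)
    next
      case 3
      show ?thesis unfolding 3 exponents_replicate by (simp add: exp_cong_def c_def)
    qed
  next
    case (cancel x e)
    show ?case by (cases x; cases e) (simp_all add: exp_cong_def)
  next
    case (refl u)
    show ?case by (rule exp_cong_refl)
  next
    case (sym u v)
    then show ?case by (blast intro: exp_cong_sym)
  next
    case (trans u v w)
    then show ?case by (blast intro: exp_cong_trans)
  next
    case (append u u' v v')
    then show ?case
      using exp_cong_trans exp_cong_sym exp_cong_mult exponents_append[OF \<open>even c\<close>] by meson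
  qed
  then show ?thesis unfolding c_def .
qed


section \<open>Coordinates on the presented group\<close>

lemma modular_coordinates_modular_group:
  assumes n: "4 \<le> n"
  shows "\<exists>E. modular_coordinates (modular_group n) E n"
proof -
  let ?G = "modular_group n" and ?W = "word_class (modular_relations n)"
  define c :: int where "c = 2 ^ (n - 2)"
  define a b where "a = ?W [(Gen_a, True)]" and "b = ?W [(Gen_b, True)]"
  interpret group ?G
    unfolding modular_group_eq by (rule group_presented_group)
  have even_c: "even c" and N: "2 ^ (n - 1) = 2 * c"
    unfolding c_def using n by (simp, simp flip: power_Suc add: Suc_diff_le numeral_eq_Suc)
  have mult: "?W u \<otimes>\<^bsub>?G\<^esub> ?W v = ?W (u @ v)" for u v
    unfolding modular_group_eq by (rule mult_presented_group)
  have one: "\<one>\<^bsub>?G\<^esub> = ?W []" and carrier: "carrier ?G = range ?W"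
    by (simp_all add: modular_group_eq presented_group_def)
  have rel: "?W u = ?W v" if "(u, v) \<in> modular_relations n" for u v
    using that unfolding word_class_eq_iff by (rule word_eq.relation)
  have ab [simp]: "a \<in> carrier ?G" "b \<in> carrier ?G"
    by (simp_all add: a_def b_def carrier)
  have inv: "?W [(g, False)] = inv\<^bsub>?G\<^esub> ?W [(g, True)]" for g
  proof -
    have "?W [(g, False)] \<otimes>\<^bsub>?G\<^esub> ?W [(g, True)] = \<one>\<^bsub>?G\<^esub>"
      using word_eq.cancel[of "modular_relations n" g False]
      by (simp add: mult one word_class_eq_iff)
    then show ?thesis
      using inv_equality carrier by (metis rangeI)
  qed
  have pow: "?W (replicate k (Gen_a, True)) = a [^]\<^bsub>?G\<^esub> int k" for k
  proof (induction k)
    case 0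
    show ?case by (simp add: one)
  next
    case (Suc k)
    have "?W (replicate (Suc k) (Gen_a, True)) = a \<otimes>\<^bsub>?G\<^esub> a [^]\<^bsub>?G\<^esub> int k"
      using mult[of "[(Gen_a, True)]" "replicate k (Gen_a, True)"] Suc.IH by (simp add: a_def)
    also have "\<dots> = a [^]\<^bsub>?G\<^esub> (1 + int k)"
      unfolding int_pow_mult[OF ab(1)] by simp
    finally show ?case by simp
  qed
  have aN: "a [^]\<^bsub>?G\<^esub> (2 * c) = \<one>\<^bsub>?G\<^esub>"
  proof -
    have "?W (replicate (2 ^ (n - 1)) (Gen_a, True)) = ?W []"
      by (rule rel) (simp add: modular_relations_def)
    then show ?thesis unfolding pow one by (simp flip: N)
  qed
  have bb: "b \<otimes>\<^bsub>?G\<^esub> b = \<one>\<^bsub>?G\<^esub>"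
    unfolding b_def mult one by (rule rel) (simp add: modular_relations_def)
  then have inv_b: "inv\<^bsub>?G\<^esub> b = b"
    by (simp add: inv_equality)
  have "b \<otimes>\<^bsub>?G\<^esub> a \<otimes>\<^bsub>?G\<^esub> inv\<^bsub>?G\<^esub> b = a [^]\<^bsub>?G\<^esub> int (1 + 2 ^ (n - 2))"
    unfolding a_def b_def inv[symmetric] mult
    unfolding pow[symmetric, unfolded a_def]
    by (intro rel) (simp add: modular_relations_def)
  then have "b \<otimes>\<^bsub>?G\<^esub> a \<otimes>\<^bsub>?G\<^esub> inv\<^bsub>?G\<^esub> b = a [^]\<^bsub>?G\<^esub> (1 + c)"
    by (simp add: c_def)
  then have ba: "b \<otimes>\<^bsub>?G\<^esub> a = a [^]\<^bsub>?G\<^esub> (1 + c) \<otimes>\<^bsub>?G\<^esub> b"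
    using inv_solve_right[of "a [^]\<^bsub>?G\<^esub> (1 + c)" "b \<otimes>\<^bsub>?G\<^esub> a" b] by simp
  have ba_pow: "b \<otimes>\<^bsub>?G\<^esub> a [^]\<^bsub>?G\<^esub> i = a [^]\<^bsub>?G\<^esub> ((1 + c) * i) \<otimes>\<^bsub>?G\<^esub> b" for i :: int
  proof -
    \<comment> \<open>An equivalence rather than an implication, so that the integer induction can
      use it upwards and downwards.\<close>
    have step: "b \<otimes>\<^bsub>?G\<^esub> a [^]\<^bsub>?G\<^esub> (i + 1) = a [^]\<^bsub>?G\<^esub> ((1 + c) * (i + 1)) \<otimes>\<^bsub>?G\<^esub> b \<longleftrightarrow>
        b \<otimes>\<^bsub>?G\<^esub> a [^]\<^bsub>?G\<^esub> i = a [^]\<^bsub>?G\<^esub> ((1 + c) * i) \<otimes>\<^bsub>?G\<^esub> b" for i :: int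
    proof -
      have "b \<otimes>\<^bsub>?G\<^esub> a [^]\<^bsub>?G\<^esub> (i + 1) = b \<otimes>\<^bsub>?G\<^esub> a [^]\<^bsub>?G\<^esub> i \<otimes>\<^bsub>?G\<^esub> a"
        by (simp add: int_pow_mult m_assoc)
      moreover have "a [^]\<^bsub>?G\<^esub> ((1 + c) * (i + 1)) \<otimes>\<^bsub>?G\<^esub> b
          = a [^]\<^bsub>?G\<^esub> ((1 + c) * i) \<otimes>\<^bsub>?G\<^esub> b \<otimes>\<^bsub>?G\<^esub> a"
      proof -
        have "a [^]\<^bsub>?G\<^esub> ((1 + c) * (i + 1)) = a [^]\<^bsub>?G\<^esub> ((1 + c) * i) \<otimes>\<^bsub>?G\<^esub> a [^]\<^bsub>?G\<^esub> (1 + c)"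
          by (simp add: distrib_left flip: int_pow_mult)
        then show ?thesis by (simp add: m_assoc ba)
      qed
      ultimately show ?thesis by simp
    qed
    show ?thesis
    proof (induction i rule: int_induct[of _ 0])
      case base
      show ?case by simp
    next
      case (step1 i)
      then show ?case by (simp only: step)
    next
      case (step2 i)
      then show ?case using step[of "i - 1", unfolded diff_add_cancel] by blast
    qed
  qed
  define E where "E = (\<lambda>(i :: int) (e :: int). a [^]\<^bsub>?G\<^esub> i \<otimes>\<^bsub>?G\<^esub> b [^]\<^bsub>?G\<^esub> e)"
  have b_E: "b \<otimes>\<^bsub>?G\<^esub> E i e = E ((1 + c) * i) (e + 1)" for i e
  proof -
    have "b \<otimes>\<^bsub>?G\<^esub> E i e = a [^]\<^bsub>?G\<^esub> ((1 + c) * i) \<otimes>\<^bsub>?G\<^esub> (b \<otimes>\<^bsub>?G\<^esub> b [^]\<^bsub>?G\<^esub> e)"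
      unfolding E_def by (simp add: ba_pow flip: m_assoc)
    also have "b \<otimes>\<^bsub>?G\<^esub> b [^]\<^bsub>?G\<^esub> e = b [^]\<^bsub>?G\<^esub> (e + 1)"
      using int_pow_mult[OF ab(2), of 1 e] by (simp add: add.commute)
    finally show ?thesis unfolding E_def .
  qed
  have E_cong: "E i e = E j f" if ij: "2 * c dvd i - j" "2 dvd e - f" for i e j f
  proof -
    obtain x y where "i - j = 2 * c * x" "e - f = 2 * y"
      using ij unfolding dvd_def by blast
    then have xy: "i = j + 2 * c * x" "e = f + 2 * y" by simp_all
    have "b [^]\<^bsub>?G\<^esub> (2 :: int) = \<one>\<^bsub>?G\<^esub>"
      using int_pow_mult[OF ab(2), of 1 1] bb by simp
    then show ?thesis
      unfolding E_def xy by (simp add: int_pow_mult aN flip: int_pow_pow)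
  qed
  \<comment> \<open>Collecting letters from the right brings every word to the form
    \<open>a^i b^e\<close> with the exponents computed by \<open>exponents\<close>.\<close>
  have W_eq: "?W w = E (fst (exponents c w)) (snd (exponents c w))" for w
  proof (induction w)
    case Nil
    show ?case by (simp add: E_def flip: one)
  next
    case (Cons x w)
    obtain g s where x: "x = (g, s)" by (cases x)
    obtain i e where w: "exponents c w = (i, e)" by fastforce
    have IH: "?W (x # w) = ?W [(g, s)] \<otimes>\<^bsub>?G\<^esub> E i e"
      using mult[of "[x]" w] Cons.IH by (simp add: x w)
    show ?case
    proof (cases g)
      case Gen_a
      have "?W [(g, s)] = a [^]\<^bsub>?G\<^esub> (if s then 1 else - 1 :: int)"
        using inv[of Gen_a] by (simp add: Gen_a a_def[symmetric] int_pow_neg)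
      then show ?thesis
        unfolding IH using Gen_a
        by (simp add: x w E_def int_pow_mult add.commute[of i] m_assoc)
    next
      case Gen_b
      have "?W [(g, s)] = b"
        using inv[of Gen_b] inv_b by (cases s) (simp_all add: Gen_b b_def[symmetric])
      then have "?W (x # w) = E ((1 + c) * i) (e + 1)"
        unfolding IH by (simp add: b_E)
      \<comment> \<open>Both signs of the letter act as \<open>b\<close>, and \<open>e + 1\<close>
        and \<open>e - 1\<close> agree modulo 2.\<close>
      also have "\<dots> = E ((1 + c) * i) (e + (if s then 1 else - 1))"
        by (rule E_cong) auto
      finally show ?thesis using Gen_b by (simp add: x w)
    qed
  qed
  have "modular_coordinates ?G E n"
  proof unfold_locales
    show "4 \<le> n" by (rule n)
    show "carrier ?G = {E i e | i e. True}"
    proof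
      show "carrier ?G \<subseteq> {E i e | i e. True}"
        unfolding carrier using W_eq by blast
      show "{E i e | i e. True} \<subseteq> carrier ?G"
        by (auto simp: E_def)
    qed
    fix i e j f
    \<comment> \<open>Words with prescribed exponents turn statements about \<open>E\<close> into
      statements about words: \<open>exponents_word_eq\<close> separates elements, and concatenation
      computes products.\<close>
    obtain u v where u: "exponents c u = (i, e)" and v: "exponents c v = (j, f)"
      using exponents_surj by metis
    show "E i e = E j f \<longleftrightarrow> 2 ^ (n - 1) dvd i - j \<and> 2 dvd e - f"
    proof
      assume "E i e = E j f"
      then have "word_eq (modular_relations n) u v"
        unfolding word_class_eq_iff[symmetric] W_eq u v by simp
      from exponents_word_eq[OF n this] show "2 ^ (n - 1) dvd i - j \<and> 2 dvd e - f"
        unfolding c_def[symmetric] u v exp_cong_def N by simp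
    next
      assume "2 ^ (n - 1) dvd i - j \<and> 2 dvd e - f"
      then show "E i e = E j f" unfolding N by (intro E_cong) simp_all
    qed
    have "E i e \<otimes>\<^bsub>?G\<^esub> E j f = ?W (u @ v)"
      using mult[of u v] W_eq[of u] W_eq[of v] by (simp add: u v)
    also have "\<dots> = E (i + j + e * j * c) (e + f)"
      unfolding W_eq[of "u @ v"]
      using exponents_append[OF even_c, of u v] by (intro E_cong) (simp_all add: exp_cong_def exp_mult_def u v)
    finally show "E i e \<otimes>\<^bsub>?G\<^esub> E j f = E (i + j + e * j * 2 ^ (n - 2)) (e + f)"
      unfolding c_def .
  qed
  then show ?thesis by blast
qed

theorem theoremC:
  fixes n :: nat
  assumes "n \<ge> 4"
  shows "width (modular_group n) = 2 * (n - 1)"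
  using modular_coordinates_modular_group[OF assms] modular_coordinates.width_eq by blast

end
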